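(* Let $(M,\kappa)$ be a symplectic manifold, let $J$ be a $\kappa$-calibrated complex structure on $M$, let $g=g_J$ with Levi-Civita connection $\nabla$, and let $B$ be the tensor $$B(X,Y)=J(\nabla_XJ)Y-(\nabla_{JX}J)Y .$$ If $\nabla''B=0$, then $M$ is a Kähler manifold, i.e. $(g,J,\kappa)$ is a Kähler structure on $M$.
   Context: A complex structure on a manifold $M$ means here a smooth section $J$ of $\mathrm{End}(TM)$ with $J^2=-\mathrm{Id}$ (i.e. an almost complex structure; integrability is not assumed). It gives a splitting $TM\otimes\mathbb{C}=TM^{(1,0)}\oplus TM^{(0,1)}$ into the eigenbundles of $J$ for the eigenvalues $i$ and $-i$ respectively. $J$ is integrable if it is induced by a holomorphic structure; equivalently its Nijenhuis tensor $N_J(X,Y)=[JX,JY]-J[JX,Y]-J[X,JY]-[X,Y]$ vanishes. A symplectic manifold is a pair $(M,\kappa)$ with $\kappa$ a closed non-degenerate 2-form. A complex structure $J$ on $(M,\kappa)$ is $\kappa$-calibrated if $\kappa(J\cdot,J\cdot)=\kappa(\cdot,\cdot)$ and $g_J(\cdot,\cdot):=\kappa(J\cdot,\cdot)$ is positive definite. A Kähler structure on $M$ is a triple $(g,J,\kappa)$ where $\kappa$ is a symplectic structure, $J$ is an integrable $\kappa$-calibrated complex structure and $g=g_J$. All tensors and the connection are extended complex-linearly to $TM\otimes\mathbb{C}$. $\nabla''$ denotes the $(0,1)$-part of the Levi-Civita connection, $\nabla''_Z:=\nabla_{Z^{(0,1)}}$, where $Z^{(0,1)}$ is the $TM^{(0,1)}$-component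 of $Z$; thus $\nabla''B=0$ means $\nabla_{\overline{Z}}B=0$ for every $Z\in TM^{(1,0)}$. *)

theory Defs
  imports "HOL-Analysis.Analysis" "HOL-Library.Function_Algebras"
begin

section \<open>Smooth manifolds\<close>

text \<open>\<open>Ck_on k S f\<close>: on the open set \<open>S\<close>, all iterated directional derivatives of \<open>f\<close> of order at
  most \<open>k\<close> exist (as Frechet derivatives) and are continuous.\<close>

primrec Ck_on ::
  "nat \<Rightarrow> 'e::real_normed_vector set \<Rightarrow> ('e \<Rightarrow> 'f::real_normed_vector) \<Rightarrow> bool"
where
  "Ck_on 0 S f \<longleftrightarrow> continuous_on S f"
| "Ck_on (Suc k) S f \<longleftrightarrow>
     (\<forall>x\<in>S. f differentiable (at x)) \<and>
     (\<forall>v. Ck_on k S (\<lambda>x. frechet_derivative f (at x) v))"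

definition smooth_on :: "'e::real_normed_vector set \<Rightarrow> ('e \<Rightarrow> 'f::real_normed_vector) \<Rightarrow> bool" where
  "smooth_on S f \<longleftrightarrow> (\<forall>k. Ck_on k S f)"

text \<open>The manifold is the whole type \<open>'m\<close>, a second countable Hausdorff space, with a (not
  necessarily maximal) atlas of charts \<open>(U, \<phi>)\<close> modelled on \<open>'e\<close>; its dimension is \<open>DIM('e)\<close>.\<close>

type_synonym ('m, 'e) chart = "'m set \<times> ('m \<Rightarrow> 'e)"

definition smooth_atlas ::
  "('m::{t2_space,second_countable_topology}, 'e::euclidean_space) chart set \<Rightarrow> bool"
where
  "smooth_atlas A \<longleftrightarrow>
     (\<Union>(U, \<phi>)\<in>A. U) = UNIV \<and>
     (\<forall>(U, \<phi>)\<in>A. open U \<and> open (\<phi> ` U) \<and> homeomorphism U (\<phi> ` U) \<phi> (inv_into U \<phi>)) \<and>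
     (\<forall>(U, \<phi>)\<in>A. \<forall>(V, \<psi>)\<in>A. smooth_on (\<phi> ` (U \<inter> V)) (\<psi> \<circ> inv_into U \<phi>))"

definition smooth_functions ::
  "('m::{t2_space,second_countable_topology}, 'e::euclidean_space) chart set \<Rightarrow> ('m \<Rightarrow> real) set"
where
  "smooth_functions A = {f. \<forall>(U, \<phi>)\<in>A. smooth_on (\<phi> ` U) (f \<circ> inv_into U \<phi>)}"

section \<open>Tangent vectors, vector fields and tensors\<close>

text \<open>Tangent vectors are derivations at a point of the algebra of smooth functions.  Addition,
  subtraction and zero of tangent vectors and of vector fields are the pointwise operations on
  functions.\<close>

type_synonym 'm tvec = "('m \<Rightarrow> real) \<Rightarrow> real"
type_synonym 'm vfield = "'m \<Rightarrow> 'm tvec"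

definition tscale :: "real \<Rightarrow> 'm tvec \<Rightarrow> 'm tvec" where
  "tscale c v = (\<lambda>f. c * v f)"

text \<open>The value of a derivation on non-smooth functions is meaningless; it is fixed to 0, so that
  tangent vectors are equal as HOL functions iff they are equal as derivations.\<close>

definition tangent_space ::
  "('m::{t2_space,second_countable_topology}, 'e::euclidean_space) chart set \<Rightarrow> 'm \<Rightarrow> 'm tvec set"
where
  "tangent_space A p = {v.
     (\<forall>f\<in>smooth_functions A. \<forall>g\<in>smooth_functions A. v (\<lambda>x. f x + g x) = v f + v g) \<and>
     (\<forall>c. \<forall>f\<in>smooth_functions A. v (\<lambda>x. c * f x) = c * v f) \<and>
     (\<forall>f\<in>smooth_functions A. \<forall>g\<in>smooth_functions A.
        v (\<lambda>x. f x * g x) = v f * g p + f p * v g) \<and>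
     (\<forall>f. f \<notin> smooth_functions A \<longrightarrow> v f = 0)}"

definition app_field :: "'m vfield \<Rightarrow> ('m \<Rightarrow> real) \<Rightarrow> ('m \<Rightarrow> real)" where
  "app_field X f = (\<lambda>p. X p f)"

definition vector_fields ::
  "('m::{t2_space,second_countable_topology}, 'e::euclidean_space) chart set \<Rightarrow> 'm vfield set"
where
  "vector_fields A = {X. (\<forall>p. X p \<in> tangent_space A p) \<and>
     (\<forall>f\<in>smooth_functions A. app_field X f \<in> smooth_functions A)}"

definition fscale :: "('m \<Rightarrow> real) \<Rightarrow> 'm vfield \<Rightarrow> 'm vfield" where
  "fscale f X = (\<lambda>p. tscale (f p) (X p))"

definition lie_bracket :: "'m vfield \<Rightarrow> 'm vfield \<Rightarrow> 'm vfield" where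
  "lie_bracket X Y = (\<lambda>p f. X p (app_field Y f) - Y p (app_field X f))"

text \<open>Sections of \<open>End(TM)\<close> and of \<open>T\<^sup>*M \<otimes> T\<^sup>*M\<close> are families of (bi)linear maps on the tangent
  spaces (values outside the tangent spaces are irrelevant); smoothness is tested on smooth vector
  fields.\<close>

type_synonym 'm endo = "'m \<Rightarrow> 'm tvec \<Rightarrow> 'm tvec"
type_synonym 'm bilin = "'m \<Rightarrow> 'm tvec \<Rightarrow> 'm tvec \<Rightarrow> real"

definition app_endo :: "'m endo \<Rightarrow> 'm vfield \<Rightarrow> 'm vfield" where
  "app_endo J X = (\<lambda>p. J p (X p))"

definition app_bilin :: "'m bilin \<Rightarrow> 'm vfield \<Rightarrow> 'm vfield \<Rightarrow> ('m \<Rightarrow> real)" where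
  "app_bilin b X Y = (\<lambda>p. b p (X p) (Y p))"

definition smooth_endo ::
  "('m::{t2_space,second_countable_topology}, 'e::euclidean_space) chart set \<Rightarrow> 'm endo \<Rightarrow> bool"
where
  "smooth_endo A J \<longleftrightarrow>
     (\<forall>p. \<forall>v\<in>tangent_space A p.
        J p v \<in> tangent_space A p \<and>
        (\<forall>w\<in>tangent_space A p. J p (v + w) = J p v + J p w) \<and>
        (\<forall>c. J p (tscale c v) = tscale c (J p v))) \<and>
     (\<forall>X\<in>vector_fields A. app_endo J X \<in> vector_fields A)"

definition smooth_2form ::
  "('m::{t2_space,second_countable_topology}, 'e::euclidean_space) chart set \<Rightarrow> 'm bilin \<Rightarrow> bool"
where
  "smooth_2form A \<omega> \<longleftrightarrow>
     (\<forall>p. \<forall>u\<in>tangent_space A p. \<forall>v\<in>tangent_space A p.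
        (\<forall>w\<in>tangent_space A p. \<omega> p (u + v) w = \<omega> p u w + \<omega> p v w) \<and>
        (\<forall>c. \<omega> p (tscale c u) v = c * \<omega> p u v) \<and>
        \<omega> p v u = - \<omega> p u v) \<and>
     (\<forall>X\<in>vector_fields A. \<forall>Y\<in>vector_fields A. app_bilin \<omega> X Y \<in> smooth_functions A)"

text \<open>The exterior derivative of a 2-form in its coordinate-free form.\<close>

definition ext_deriv2 ::
  "'m bilin \<Rightarrow> 'm vfield \<Rightarrow> 'm vfield \<Rightarrow> 'm vfield \<Rightarrow> ('m \<Rightarrow> real)"
where
  "ext_deriv2 \<omega> X Y Z =
     app_field X (app_bilin \<omega> Y Z) - app_field Y (app_bilin \<omega> X Z)
       + app_field Z (app_bilin \<omega> X Y)
     - app_bilin \<omega> (lie_bracket X Y) Z + app_bilin \<omega> (lie_bracket X Z) Y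
       - app_bilin \<omega> (lie_bracket Y Z) X"

section \<open>Symplectic, complex and Kaehler structures\<close>

definition symplectic_form ::
  "('m::{t2_space,second_countable_topology}, 'e::euclidean_space) chart set \<Rightarrow> 'm bilin \<Rightarrow> bool"
where
  "symplectic_form A \<kappa> \<longleftrightarrow>
     smooth_2form A \<kappa> \<and>
     (\<forall>X\<in>vector_fields A. \<forall>Y\<in>vector_fields A. \<forall>Z\<in>vector_fields A. ext_deriv2 \<kappa> X Y Z = 0) \<and>
     (\<forall>p. \<forall>v\<in>tangent_space A p. (\<forall>w\<in>tangent_space A p. \<kappa> p v w = 0) \<longrightarrow> v = 0)"

text \<open>Integrability is not part of the following notion.\<close>

definition complex_structure ::
  "('m::{t2_space,second_countable_topology}, 'e::euclidean_space) chart set \<Rightarrow> 'm endo \<Rightarrow> bool"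
where
  "complex_structure A J \<longleftrightarrow>
     smooth_endo A J \<and> (\<forall>p. \<forall>v\<in>tangent_space A p. J p (J p v) = - v)"

definition nijenhuis :: "'m endo \<Rightarrow> 'm vfield \<Rightarrow> 'm vfield \<Rightarrow> 'm vfield" where
  "nijenhuis J X Y =
     lie_bracket (app_endo J X) (app_endo J Y)
     - app_endo J (lie_bracket (app_endo J X) Y)
     - app_endo J (lie_bracket X (app_endo J Y))
     - lie_bracket X Y"

text \<open>Vanishing of the Nijenhuis tensor; by Newlander-Nirenberg this is equivalent to \<open>J\<close> being
  induced by a holomorphic atlas.\<close>

definition integrable_structure ::
  "('m::{t2_space,second_countable_topology}, 'e::euclidean_space) chart set \<Rightarrow> 'm endo \<Rightarrow> bool"
where
  "integrable_structure A J \<longleftrightarrow>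
     (\<forall>X\<in>vector_fields A. \<forall>Y\<in>vector_fields A. nijenhuis J X Y = 0)"

definition metric_of :: "'m bilin \<Rightarrow> 'm endo \<Rightarrow> 'm bilin" where
  "metric_of \<kappa> J = (\<lambda>p v w. \<kappa> p (J p v) w)"

definition calibrated ::
  "('m::{t2_space,second_countable_topology}, 'e::euclidean_space) chart set \<Rightarrow>
     'm bilin \<Rightarrow> 'm endo \<Rightarrow> bool"
where
  "calibrated A \<kappa> J \<longleftrightarrow>
     (\<forall>p. \<forall>v\<in>tangent_space A p. \<forall>w\<in>tangent_space A p. \<kappa> p (J p v) (J p w) = \<kappa> p v w) \<and>
     (\<forall>p. \<forall>v\<in>tangent_space A p. v \<noteq> 0 \<longrightarrow> metric_of \<kappa> J p v v > 0)"

definition kaehler_structure ::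
  "('m::{t2_space,second_countable_topology}, 'e::euclidean_space) chart set \<Rightarrow>
     'm bilin \<Rightarrow> 'm endo \<Rightarrow> 'm bilin \<Rightarrow> bool"
where
  "kaehler_structure A g J \<kappa> \<longleftrightarrow>
     smooth_atlas A \<and>
     symplectic_form A \<kappa> \<and>
     complex_structure A J \<and> integrable_structure A J \<and> calibrated A \<kappa> J \<and>
     (\<forall>p. \<forall>v\<in>tangent_space A p. \<forall>w\<in>tangent_space A p. g p v w = metric_of \<kappa> J p v w)"

section \<open>The Levi-Civita connection\<close>

definition affine_connection ::
  "('m::{t2_space,second_countable_topology}, 'e::euclidean_space) chart set \<Rightarrow>
     ('m vfield \<Rightarrow> 'm vfield \<Rightarrow> 'm vfield) \<Rightarrow> bool"
where
  "affine_connection A D \<longleftrightarrow>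
     (\<forall>X\<in>vector_fields A. \<forall>Y\<in>vector_fields A. D X Y \<in> vector_fields A) \<and>
     (\<forall>X\<in>vector_fields A. \<forall>Y\<in>vector_fields A. \<forall>Z\<in>vector_fields A.
        D (X + Y) Z = D X Z + D Y Z \<and> D X (Y + Z) = D X Y + D X Z) \<and>
     (\<forall>f\<in>smooth_functions A. \<forall>X\<in>vector_fields A. \<forall>Y\<in>vector_fields A.
        D (fscale f X) Y = fscale f (D X Y) \<and>
        D X (fscale f Y) = fscale (app_field X f) Y + fscale f (D X Y))"

definition levi_civita ::
  "('m::{t2_space,second_countable_topology}, 'e::euclidean_space) chart set \<Rightarrow>
     'm bilin \<Rightarrow> ('m vfield \<Rightarrow> 'm vfield \<Rightarrow> 'm vfield) \<Rightarrow> bool"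
where
  "levi_civita A g D \<longleftrightarrow>
     affine_connection A D \<and>
     (\<forall>X\<in>vector_fields A. \<forall>Y\<in>vector_fields A. D X Y - D Y X = lie_bracket X Y) \<and>
     (\<forall>X\<in>vector_fields A. \<forall>Y\<in>vector_fields A. \<forall>Z\<in>vector_fields A.
        app_field X (app_bilin g Y Z) = app_bilin g (D X Y) Z + app_bilin g Y (D X Z))"

text \<open>\<open>cov_deriv_endo D J X Y\<close> is \<open>(\<nabla>\<^sub>X J) Y\<close>.\<close>

definition cov_deriv_endo ::
  "('m vfield \<Rightarrow> 'm vfield \<Rightarrow> 'm vfield) \<Rightarrow> 'm endo \<Rightarrow> 'm vfield \<Rightarrow> 'm vfield \<Rightarrow> 'm vfield"
where
  "cov_deriv_endo D J X Y = D X (app_endo J Y) - app_endo J (D X Y)"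

definition B_tensor ::
  "('m vfield \<Rightarrow> 'm vfield \<Rightarrow> 'm vfield) \<Rightarrow> 'm endo \<Rightarrow> 'm vfield \<Rightarrow> 'm vfield \<Rightarrow> 'm vfield"
where
  "B_tensor D J X Y =
     app_endo J (cov_deriv_endo D J X Y) - cov_deriv_endo D J (app_endo J X) Y"

section \<open>Complexification\<close>

text \<open>A section \<open>X + iY\<close> of \<open>TM \<otimes> \<complex>\<close> is the pair \<open>(X, Y)\<close> of its real and imaginary parts.\<close>

type_synonym 'm cfield = "'m vfield \<times> 'm vfield"

definition complex_fields ::
  "('m::{t2_space,second_countable_topology}, 'e::euclidean_space) chart set \<Rightarrow> 'm cfield set"
where
  "complex_fields A = vector_fields A \<times> vector_fields A"

definition times_i :: "'m cfield \<Rightarrow> 'm cfield" where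
  "times_i Z = (- snd Z, fst Z)"

text \<open>Complex-linear extensions of real-linear and real-bilinear operations.\<close>

definition cext1 :: "('m vfield \<Rightarrow> 'm vfield) \<Rightarrow> 'm cfield \<Rightarrow> 'm cfield" where
  "cext1 F Z = (F (fst Z), F (snd Z))"

definition cext2 ::
  "('m vfield \<Rightarrow> 'm vfield \<Rightarrow> 'm vfield) \<Rightarrow> 'm cfield \<Rightarrow> 'm cfield \<Rightarrow> 'm cfield"
where
  "cext2 F Z W =
     (F (fst Z) (fst W) - F (snd Z) (snd W), F (fst Z) (snd W) + F (snd Z) (fst W))"

definition T10 ::
  "('m::{t2_space,second_countable_topology}, 'e::euclidean_space) chart set \<Rightarrow>
     'm endo \<Rightarrow> 'm cfield set"
where
  "T10 A J = {Z \<in> complex_fields A. cext1 (app_endo J) Z = times_i Z}"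

definition T01 ::
  "('m::{t2_space,second_countable_topology}, 'e::euclidean_space) chart set \<Rightarrow>
     'm endo \<Rightarrow> 'm cfield set"
where
  "T01 A J = {Z \<in> complex_fields A. cext1 (app_endo J) Z = - times_i Z}"

definition part01 ::
  "('m::{t2_space,second_countable_topology}, 'e::euclidean_space) chart set \<Rightarrow>
     'm endo \<Rightarrow> 'm cfield \<Rightarrow> 'm cfield"
where
  "part01 A J Z = (THE W. W \<in> T01 A J \<and> Z - W \<in> T10 A J)"

text \<open>\<open>cov_deriv_tensor21 D B Z X Y\<close> is \<open>(\<nabla>\<^sub>Z B)(X, Y)\<close> for a vector-valued bilinear tensor \<open>B\<close>,
  with everything extended complex-linearly.\<close>

definition cov_deriv_tensor21 ::
  "('m vfield \<Rightarrow> 'm vfield \<Rightarrow> 'm vfield) \<Rightarrow> ('m vfield \<Rightarrow> 'm vfield \<Rightarrow> 'm vfield) \<Rightarrow>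
     'm cfield \<Rightarrow> 'm cfield \<Rightarrow> 'm cfield \<Rightarrow> 'm cfield"
where
  "cov_deriv_tensor21 D B Z X Y =
     cext2 D Z (cext2 B X Y) - cext2 B (cext2 D Z X) Y - cext2 B X (cext2 D Z Y)"

text \<open>\<open>nabla01_tensor21 A J D B Z\<close> is \<open>\<nabla>''\<^sub>Z B\<close>.\<close>

definition nabla01_tensor21 ::
  "('m::{t2_space,second_countable_topology}, 'e::euclidean_space) chart set \<Rightarrow> 'm endo \<Rightarrow>
     ('m vfield \<Rightarrow> 'm vfield \<Rightarrow> 'm vfield) \<Rightarrow> ('m vfield \<Rightarrow> 'm vfield \<Rightarrow> 'm vfield) \<Rightarrow>
     'm cfield \<Rightarrow> 'm cfield \<Rightarrow> 'm cfield \<Rightarrow> 'm cfield"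
where
  "nabla01_tensor21 A J D B Z = cov_deriv_tensor21 D B (part01 A J Z)"

end

theory Submission
  imports Defs
begin

text \<open>
  Write \<open>P\<^sub>X = \<nabla>\<^sub>X J\<close> and \<open>B\<^sub>X = J P\<^sub>X - P\<^bsub>JX\<^esub>\<close>, both endomorphisms of \<open>TM\<close>.  The tensor \<open>B\<close> is real, so
  for real \<open>X, Y, Z\<close> the real part of \<open>(\<nabla>''\<^bsub>2Z\<^esub> B)(X, Y) = (\<nabla>\<^sub>Z B)(X, Y) + i (\<nabla>\<^bsub>JZ\<^esub> B)(X, Y)\<close> is
  \<open>(\<nabla>\<^sub>Z B)(X, Y)\<close>: the hypothesis \<open>\<nabla>'' B = 0\<close> already forces the whole covariant derivative of \<open>B\<close>
  to vanish.

  Parallelism of \<open>B\<close> kills \<open>B\<close>.  Since \<open>J\<^sup>2 = -1\<close>, the endomorphisms \<open>P\<^sub>X\<close> anticommute with \<open>J\<close>, and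
  therefore \<open>B\<^sub>X J = - J B\<^sub>X\<close> and \<open>B\<^bsub>JX\<^esub> = - J B\<^sub>X\<close>.  Differentiating the first identity along \<open>Z\<close> gives
  \<open>P\<^sub>Z B\<^sub>X = - B\<^sub>X P\<^sub>Z\<close>.  Replacing \<open>X\<close> by \<open>JX\<close> in this relation changes the relative sign of its two sides,
  so \<open>P\<^sub>Z B\<^sub>X = 0\<close> for all \<open>X\<close> and \<open>Z\<close>; hence \<open>B\<^sub>Z B\<^sub>X = 0\<close>, in particular \<open>B\<^sub>X\<^sup>2 = 0\<close>.
  As \<open>J\<close> is orthogonal and \<open>\<nabla>\<close> is metric, \<open>B\<^sub>X\<close> is skew-adjoint, and a skew-adjoint endomorphism of
  a Euclidean space with vanishing square is zero: \<open>|B\<^sub>X Y|\<^sup>2 = - \<langle>Y, B\<^sub>X\<^sup>2 Y\<rangle> = 0\<close>.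

  Finally, as \<open>\<nabla>\<close> is torsion free, the Nijenhuis tensor is \<open>N\<^sub>J(X, Y) = B(Y, X) - B(X, Y)\<close>, which now
  vanishes.

  Everything in this argument is algebra in the additive group of vector fields, which the locale
  \<open>hermitian_calculus\<close> isolates.
\<close>

section \<open>Algebra of a metric connection and an orthogonal complex structure\<close>

definition additive_on :: "'a::ab_group_add set \<Rightarrow> ('a \<Rightarrow> 'b::ab_group_add) \<Rightarrow> bool" where
  "additive_on V f \<longleftrightarrow> (\<forall>x\<in>V. \<forall>y\<in>V. f (x + y) = f x + f y)"

locale additive_subgroup =
  fixes V :: "'v::ab_group_add set"
  assumes zero [simp]: "0 \<in> V"
    and add [simp]: "x \<in> V \<Longrightarrow> y \<in> V \<Longrightarrow> x + y \<in> V"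
    and uminus [simp]: "x \<in> V \<Longrightarrow> - x \<in> V"
begin

lemma diff [simp]: "x \<in> V \<Longrightarrow> y \<in> V \<Longrightarrow> x - y \<in> V"
  using add[of x "- y"] by simp

lemma additive_on_add:
  "additive_on V f \<Longrightarrow> x \<in> V \<Longrightarrow> y \<in> V \<Longrightarrow> f (x + y) = f x + f y"
  by (simp add: additive_on_def)

lemma additive_on_zero:
  assumes "additive_on V f" shows "f 0 = 0"
  using additive_on_add[OF assms zero zero] by simp

lemma additive_on_uminus:
  assumes "additive_on V f" "x \<in> V" shows "f (- x) = - f x"
  using additive_on_add[OF assms uminus[OF assms(2)]] additive_on_zero[OF assms(1)]
  by (simp add: eq_neg_iff_add_eq_0 add.commute)

lemma additive_on_diff:
  assumes "additive_on V f" "x \<in> V" "y \<in> V" shows "f (x - y) = f x - f y"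
  using additive_on_add[OF assms(1,2) uminus[OF assms(3)]] additive_on_uminus[OF assms(1,3)]
  by simp

end

text \<open>
  Here \<open>V\<close> plays the role of the vector fields, \<open>'r\<close> that of the functions, and \<open>der X f\<close> is the
  derivative of \<open>f\<close> along \<open>X\<close>.  Additive groups, with no element of order two in \<open>V\<close>, stand in for
  modules over the smooth functions, since the argument consists of sums and signs.
\<close>

locale hermitian_calculus = additive_subgroup V
  for V :: "'v::ab_group_add set" +
  fixes J :: "'v \<Rightarrow> 'v"
    and D :: "'v \<Rightarrow> 'v \<Rightarrow> 'v"
    and g :: "'v \<Rightarrow> 'v \<Rightarrow> 'r::ab_group_add"
    and der :: "'v \<Rightarrow> 'r \<Rightarrow> 'r"
  assumes no_two_torsion: "X \<in> V \<Longrightarrow> X + X = 0 \<Longrightarrow> X = 0"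
    and J_closed [simp]: "X \<in> V \<Longrightarrow> J X \<in> V"
    and J_additive: "additive_on V J"
    and J_J [simp]: "X \<in> V \<Longrightarrow> J (J X) = - X"
    and D_closed [simp]: "X \<in> V \<Longrightarrow> Y \<in> V \<Longrightarrow> D X Y \<in> V"
    and D_additive_left: "Y \<in> V \<Longrightarrow> additive_on V (\<lambda>X. D X Y)"
    and D_additive_right: "X \<in> V \<Longrightarrow> additive_on V (D X)"
    and g_additive_left: "Y \<in> V \<Longrightarrow> additive_on V (\<lambda>X. g X Y)"
    and g_additive_right: "X \<in> V \<Longrightarrow> additive_on V (g X)"
    and g_definite: "X \<in> V \<Longrightarrow> g X X = 0 \<Longrightarrow> X = 0"
    and g_J_J: "X \<in> V \<Longrightarrow> Y \<in> V \<Longrightarrow> g (J X) (J Y) = g X Y"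
    and D_metric: "X \<in> V \<Longrightarrow> Y \<in> V \<Longrightarrow> Z \<in> V \<Longrightarrow> der X (g Y Z) = g (D X Y) Z + g Y (D X Z)"
begin

lemmas J_simps [simp] =
  additive_on_zero[OF J_additive] additive_on_add[OF J_additive]
  additive_on_uminus[OF J_additive] additive_on_diff[OF J_additive]

lemmas D_simps [simp] =
  additive_on_zero[OF D_additive_left] additive_on_add[OF D_additive_left]
  additive_on_uminus[OF D_additive_left] additive_on_diff[OF D_additive_left]
  additive_on_zero[OF D_additive_right] additive_on_add[OF D_additive_right]
  additive_on_uminus[OF D_additive_right] additive_on_diff[OF D_additive_right]

lemmas g_simps [simp] =
  additive_on_zero[OF g_additive_left] additive_on_add[OF g_additive_left]
  additive_on_uminus[OF g_additive_left] additive_on_diff[OF g_additive_left]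
  additive_on_zero[OF g_additive_right] additive_on_add[OF g_additive_right]
  additive_on_uminus[OF g_additive_right] additive_on_diff[OF g_additive_right]

definition P :: "'v \<Rightarrow> 'v \<Rightarrow> 'v" where
  "P X Y = D X (J Y) - J (D X Y)"

definition B :: "'v \<Rightarrow> 'v \<Rightarrow> 'v" where
  "B X Y = J (P X Y) - P (J X) Y"

lemma P_closed [simp]: "X \<in> V \<Longrightarrow> Y \<in> V \<Longrightarrow> P X Y \<in> V"
  by (simp add: P_def)

lemma B_closed [simp]: "X \<in> V \<Longrightarrow> Y \<in> V \<Longrightarrow> B X Y \<in> V"
  by (simp add: B_def)

lemma P_additive_left: "Y \<in> V \<Longrightarrow> additive_on V (\<lambda>X. P X Y)"
  and P_additive_right: "X \<in> V \<Longrightarrow> additive_on V (P X)"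
  by (simp_all add: additive_on_def P_def algebra_simps)

lemmas P_simps [simp] =
  additive_on_uminus[OF P_additive_left]
  additive_on_add[OF P_additive_left] additive_on_add[OF P_additive_right]
  additive_on_zero[OF P_additive_right]
  additive_on_uminus[OF P_additive_right] additive_on_diff[OF P_additive_right]

lemma B_additive_left: "Y \<in> V \<Longrightarrow> additive_on V (\<lambda>X. B X Y)"
  and B_additive_right: "X \<in> V \<Longrightarrow> additive_on V (B X)"
  by (simp_all add: additive_on_def B_def algebra_simps)

lemmas B_simps [simp] =
  additive_on_zero[OF B_additive_left]
  additive_on_zero[OF B_additive_right] additive_on_add[OF B_additive_right]

text \<open>This is the covariant derivative of \<open>J\<^sup>2 = -1\<close>.\<close>

lemma P_J: "X \<in> V \<Longrightarrow> Y \<in> V \<Longrightarrow> P X (J Y) = - J (P X Y)"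
  by (simp add: P_def)

lemma B_right_J: "X \<in> V \<Longrightarrow> Y \<in> V \<Longrightarrow> B X (J Y) = - J (B X Y)"
  by (simp add: B_def P_J)

lemma B_left_J: "X \<in> V \<Longrightarrow> Y \<in> V \<Longrightarrow> B (J X) Y = - J (B X Y)"
  by (simp add: B_def)

lemma J_skew: "X \<in> V \<Longrightarrow> Y \<in> V \<Longrightarrow> g (J X) Y = - g X (J Y)"
  using g_J_J[of X "J Y"] by (simp add: eq_neg_iff_add_eq_0 neg_eq_iff_add_eq_0)

text \<open>Differentiating \<open>g (J Y) (J W) = g Y W\<close> along \<open>X\<close> leaves only the terms with \<open>\<nabla>\<^sub>X J\<close>.\<close>

lemma P_skew:
  assumes "X \<in> V" "Y \<in> V" "W \<in> V"
  shows "g (P X Y) W = - g Y (P X W)"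
proof -
  have *: "g (P X Y) (J W) = - g (J Y) (P X W)" if "W \<in> V" for W
  proof -
    have "g (D X (J Y)) (J W) + g (J Y) (D X (J W)) = g (D X Y) W + g Y (D X W)"
      using D_metric[of X "J Y" "J W"] D_metric[of X Y W] assms that by (simp add: g_J_J)
    also have "\<dots> = g (J (D X Y)) (J W) + g (J Y) (J (D X W))"
      using assms that by (simp add: g_J_J)
    finally show ?thesis
      using assms that by (simp add: P_def algebra_simps)
  qed
  have "g (P X Y) (J (J W)) = - g (J Y) (P X (J W))"
    using *[of "J W"] assms by simp
  then show ?thesis
    using assms by (simp add: P_J g_J_J neg_eq_iff_add_eq_0 eq_neg_iff_add_eq_0)
qed

lemma B_skew:
  assumes "X \<in> V" "Y \<in> V" "W \<in> V"
  shows "g (B X Y) W = - g Y (B X W)"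
proof -
  have "g (J (P X Y)) W = - g Y (J (P X W))"
    using assms by (simp add: J_skew P_skew P_J)
  then show ?thesis
    using assms by (simp add: B_def P_skew)
qed

text \<open>Expressing the Lie brackets of a torsion-free connection by \<open>D\<close>, the left-hand side below is
  the Nijenhuis tensor.\<close>

lemma nijenhuis_eq_B:
  assumes "X \<in> V" "Y \<in> V"
  shows "(D (J X) (J Y) - D (J Y) (J X)) - J (D (J X) Y - D Y (J X))
      - J (D X (J Y) - D (J Y) X) - (D X Y - D Y X) = B Y X - B X Y"
  using assms by (simp add: B_def P_def algebra_simps)

context
  assumes B_parallel:
    "\<And>Z X Y. Z \<in> V \<Longrightarrow> X \<in> V \<Longrightarrow> Y \<in> V \<Longrightarrow> D Z (B X Y) = B (D Z X) Y + B X (D Z Y)"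
begin

text \<open>This is the covariant derivative of \<open>J B\<^sub>X = - B\<^sub>X J\<close>, in which only \<open>J\<close> is not parallel.\<close>

lemma P_B_anticommute:
  assumes "Z \<in> V" "X \<in> V" "Y \<in> V"
  shows "P Z (B X Y) = - B X (P Z Y)"
proof -
  have "P Z (B X Y) = - D Z (B X (J Y)) - J (D Z (B X Y))"
    using assms by (simp add: P_def B_right_J)
  also have "\<dots> = - B X (D Z (J Y)) - J (B X (D Z Y))"
    using assms by (simp add: B_parallel B_right_J[of X "D Z Y"] B_right_J[of "D Z X" Y])
  also have "\<dots> = - B X (P Z Y)"
    using assms by (simp add: P_def additive_on_diff[OF B_additive_right] B_right_J)
  finally show ?thesis .
qed

text \<open>Both sides of \<open>P\<^sub>Z B\<^sub>X = - B\<^sub>X P\<^sub>Z\<close> pick up a factor \<open>J\<close> when \<open>X\<close> is replaced by \<open>JX\<close>, but on the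
  left it has to be moved across \<open>P\<^sub>Z\<close>, which costs a sign.\<close>

lemma P_B_eq_0:
  assumes "Z \<in> V" "X \<in> V" "Y \<in> V"
  shows "P Z (B X Y) = 0"
proof -
  let ?U = "J (P Z (B X Y))"
  have "?U = P Z (B (J X) Y)"
    using assms by (simp add: B_left_J P_J)
  also have "\<dots> = - B (J X) (P Z Y)"
    using assms by (simp add: P_B_anticommute)
  also have "\<dots> = J (B X (P Z Y))"
    using assms by (simp add: B_left_J)
  also have "\<dots> = - ?U"
    using assms by (simp add: P_B_anticommute)
  finally have "?U + ?U = 0"
    by (simp add: eq_neg_iff_add_eq_0)
  then have "?U = 0"
    using assms no_two_torsion[of ?U] by simp
  then have "J ?U = J 0" by simp
  then show ?thesis using assms by simp
qed

text \<open>\<open>B\<^sub>X\<^sup>2 = 0\<close>, because \<open>B\<^sub>X\<close> is built from \<open>P\<^sub>X\<close> and \<open>P\<^bsub>JX\<^esub>\<close>, which vanish on the image of \<open>B\<^sub>X\<close>.\<close>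

lemma parallel_B_eq_0:
  assumes "X \<in> V" "Y \<in> V"
  shows "B X Y = 0"
proof -
  have "B X (B X Y) = 0"
    using assms by (simp add: B_def[of X "B X Y"] P_B_eq_0)
  then have "g (B X Y) (B X Y) = 0"
    using assms by (simp add: B_skew)
  then show ?thesis
    using assms by (simp add: g_definite)
qed

end

end


section \<open>Vector fields form a group\<close>

text \<open>The function \<open>u\<close> is compared with the linear combination on \<open>S\<close> alone, so that the induction
  hypothesis applies to \<open>frechet_derivative u\<close>, whose value off \<open>S\<close> is unknown; openness of \<open>S\<close> makes
  the derivatives at points of \<open>S\<close> depend on \<open>u\<close> restricted to \<open>S\<close>.\<close>

lemma Ck_on_linear_combination:
  assumes "open S" "Ck_on k S f" "Ck_on k S h" "\<And>x. x \<in> S \<Longrightarrow> u x = a *\<^sub>R f x + b *\<^sub>R h x"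
  shows "Ck_on k S u"
  using assms(2-4)
proof (induction k arbitrary: f h u)
  case 0
  have "continuous_on S (\<lambda>x. a *\<^sub>R f x + b *\<^sub>R h x)"
    using 0 by (intro continuous_intros) auto
  then show ?case
    using 0(3) by (simp cong: continuous_on_cong)
next
  case (Suc k)
  have deriv: "(u has_derivative
      (\<lambda>v. a *\<^sub>R frechet_derivative f (at x) v + b *\<^sub>R frechet_derivative h (at x) v)) (at x)"
    if "x \<in> S" for x
  proof (rule has_derivative_transform_within_open[OF _ \<open>open S\<close> that])
    have "(f has_derivative frechet_derivative f (at x)) (at x)"
      "(h has_derivative frechet_derivative h (at x)) (at x)"
      using Suc.prems that by (auto simp: frechet_derivative_works)
    then show "((\<lambda>x. a *\<^sub>R f x + b *\<^sub>R h x) has_derivative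
        (\<lambda>v. a *\<^sub>R frechet_derivative f (at x) v + b *\<^sub>R frechet_derivative h (at x) v)) (at x)"
      by (intro derivative_intros)
  qed (simp add: Suc.prems)
  have "Ck_on k S (\<lambda>x. frechet_derivative u (at x) v)" for v
  proof (rule Suc.IH)
    show "Ck_on k S (\<lambda>x. frechet_derivative f (at x) v)"
      "Ck_on k S (\<lambda>x. frechet_derivative h (at x) v)"
      using Suc.prems by auto
  qed (simp add: frechet_derivative_at[OF deriv, symmetric])
  then show ?case
    using deriv by (auto simp: differentiable_def)
qed

lemma smooth_functions_linear_combination:
  assumes "smooth_atlas A" "f \<in> smooth_functions A" "h \<in> smooth_functions A"
  shows "(\<lambda>x. a * f x + b * h x) \<in> smooth_functions A"
proof -
  have "Ck_on k (\<phi> ` U) ((\<lambda>x. a * f x + b * h x) \<circ> inv_into U \<phi>)" if "(U, \<phi>) \<in> A" for U \<phi> k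
  proof (rule Ck_on_linear_combination)
    show "open (\<phi> ` U)"
      using assms(1) that by (auto simp: smooth_atlas_def)
    show "Ck_on k (\<phi> ` U) (f \<circ> inv_into U \<phi>)" "Ck_on k (\<phi> ` U) (h \<circ> inv_into U \<phi>)"
      using assms(2,3) that by (auto simp: smooth_functions_def smooth_on_def)
  qed simp
  then show ?thesis
    by (auto simp: smooth_functions_def smooth_on_def)
qed

lemma tangent_space_linear_combination:
  assumes "v \<in> tangent_space A p" "w \<in> tangent_space A p"
  shows "(\<lambda>f. a * v f + b * w f) \<in> tangent_space A p"
  using assms by (simp add: tangent_space_def algebra_simps)

lemma vector_fields_linear_combination:
  assumes "smooth_atlas A" "X \<in> vector_fields A" "Y \<in> vector_fields A"
  shows "(\<lambda>p f. a * X p f + b * Y p f) \<in> vector_fields A"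
  using assms smooth_functions_linear_combination[OF assms(1)]
  by (simp add: vector_fields_def app_field_def tangent_space_linear_combination)

lemma vector_fields_subgroup:
  assumes "smooth_atlas A"
  shows "additive_subgroup (vector_fields A)"
proof
  show "0 \<in> vector_fields A"
    using smooth_functions_linear_combination[OF assms, of _ _ 0 0]
    by (auto simp: vector_fields_def tangent_space_def app_field_def)
  show "Y + Z \<in> vector_fields A" if "Y \<in> vector_fields A" "Z \<in> vector_fields A" for Y Z
    using vector_fields_linear_combination[OF assms that, of 1 1]
    by (simp add: plus_fun_def)
  show "- Y \<in> vector_fields A" if "Y \<in> vector_fields A" for Y
    using vector_fields_linear_combination[OF assms that that, of "-1" 0]
    by (simp add: fun_Compl_def)
qed

section \<open>From the manifold to the algebra\<close>

lemma vfield_add_self_eq_0: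
  fixes X :: "'m vfield"
  assumes "X + X = 0"
  shows "X = 0"
  using assms by (auto simp: fun_eq_iff)

lemma vector_fieldsD: "X \<in> vector_fields A \<Longrightarrow> X p \<in> tangent_space A p"
  by (simp add: vector_fields_def)

text \<open>The decomposition of the real field \<open>2Z\<close> is \<open>2Z = (Z - iJZ) + (Z + iJZ)\<close>; starting from \<open>2Z\<close>
  instead of \<open>Z\<close> avoids denominators.\<close>

lemma part01_double:
  fixes A :: "('m::{t2_space,second_countable_topology}, 'e::euclidean_space) chart set"
  assumes "smooth_atlas A" "complex_structure A J" "Z \<in> vector_fields A"
  shows "part01 A J (Z + Z, 0) = (Z, app_endo J Z)"
proof -
  interpret additive_subgroup "vector_fields A"
    using vector_fields_subgroup assms by blast
  have J: "app_endo J X \<in> vector_fields A" "app_endo J (app_endo J X) = - X"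
    if "X \<in> vector_fields A" for X
    using assms that
    by (auto simp: complex_structure_def smooth_endo_def app_endo_def fun_eq_iff vector_fieldsD)
  have J_additive: "additive_on (vector_fields A) (app_endo J)"
    using assms
    by (auto simp: complex_structure_def smooth_endo_def app_endo_def fun_eq_iff additive_on_def
        vector_fieldsD)
  note J_rules = J additive_on_uminus[OF J_additive] additive_on_diff[OF J_additive]
  show ?thesis
    unfolding part01_def
  proof (rule the_equality)
    show "(Z, app_endo J Z) \<in> T01 A J \<and> (Z + Z, 0) - (Z, app_endo J Z) \<in> T10 A J"
      using assms
      by (simp add: T01_def T10_def complex_fields_def cext1_def times_i_def J_rules)
  next
    fix W assume W: "W \<in> T01 A J \<and> (Z + Z, 0) - W \<in> T10 A J"
    obtain W1 W2 where [simp]: "W = (W1, W2)" by fastforce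
    have mem: "W1 \<in> vector_fields A" "W2 \<in> vector_fields A"
      and "app_endo J W1 = W2" "app_endo J (Z + Z - W1) = W2"
      using W by (auto simp: T01_def T10_def complex_fields_def cext1_def times_i_def)
    \<comment> \<open>The real part \<open>W1\<close> satisfies \<open>J W1 = J (2Z - W1)\<close>, so \<open>W1 = Z\<close>.\<close>
    then have "app_endo J (app_endo J W1) = app_endo J (app_endo J (Z + Z - W1))"
      by simp
    then have "- W1 = - (Z + Z - W1)"
      using mem assms by (simp only: J add diff)
    then have "(W1 - Z) + (W1 - Z) = 0"
      by (simp add: algebra_simps)
    then have "W1 = Z"
      using vfield_add_self_eq_0[of "W1 - Z"] by simp
    then show "W = (Z, app_endo J Z)"
      using \<open>app_endo J W1 = W2\<close> by simp
  qed
qed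

lemma hermitian_calculus_vector_fields:
  fixes A :: "('m::{t2_space,second_countable_topology}, 'e::euclidean_space) chart set"
  assumes "smooth_atlas A" "smooth_2form A \<kappa>" "complex_structure A J" "calibrated A \<kappa> J"
    and "levi_civita A (metric_of \<kappa> J) D"
  shows "hermitian_calculus (vector_fields A) (app_endo J) D (app_bilin (metric_of \<kappa> J)) app_field"
proof -
  interpret additive_subgroup "vector_fields A"
    using vector_fields_subgroup assms by blast
  have J: "J p v \<in> tangent_space A p" "J p (J p v) = - v"
    "w \<in> tangent_space A p \<Longrightarrow> J p (v + w) = J p v + J p w"
    if "v \<in> tangent_space A p" for p v w
    using assms that by (auto simp: complex_structure_def smooth_endo_def)
  have \<kappa>_left: "\<kappa> p (u + v) w = \<kappa> p u w + \<kappa> p v w"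
    if "u \<in> tangent_space A p" "v \<in> tangent_space A p" "w \<in> tangent_space A p" for p u v w
    using assms(2) that unfolding smooth_2form_def by blast
  have \<kappa>_skew: "\<kappa> p v u = - \<kappa> p u v"
    if "u \<in> tangent_space A p" "v \<in> tangent_space A p" for p u v
    using assms(2) that unfolding smooth_2form_def by blast
  have tangent_add: "u + v \<in> tangent_space A p"
    if "u \<in> tangent_space A p" "v \<in> tangent_space A p" for p u v
    using tangent_space_linear_combination[OF that, of 1 1] by (simp add: plus_fun_def)
  have \<kappa>_right: "\<kappa> p w (u + v) = \<kappa> p w u + \<kappa> p w v"
    if "u \<in> tangent_space A p" "v \<in> tangent_space A p" "w \<in> tangent_space A p" for p u v w
    using that \<kappa>_skew[of w p "u + v"] \<kappa>_skew[of w p u] \<kappa>_skew[of w p v]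
    by (simp add: \<kappa>_left tangent_add)
  note defs = additive_on_def app_bilin_def app_endo_def metric_of_def fun_eq_iff vector_fieldsD
  show ?thesis
  proof
    show "X = 0" if "X + X = 0" for X :: "'m vfield"
      using that by (rule vfield_add_self_eq_0)
    show "app_endo J X \<in> vector_fields A" if "X \<in> vector_fields A" for X
      using assms that by (auto simp: complex_structure_def smooth_endo_def)
    show "additive_on (vector_fields A) (app_endo J)"
      by (simp add: defs J)
    show "app_endo J (app_endo J X) = - X" if "X \<in> vector_fields A" for X
      using that by (simp add: defs J)
    show "D X Y \<in> vector_fields A" if "X \<in> vector_fields A" "Y \<in> vector_fields A" for X Y
      using assms that by (simp add: levi_civita_def affine_connection_def)
    show "additive_on (vector_fields A) (\<lambda>X. D X Y)" if "Y \<in> vector_fields A" for Y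
      using assms that by (simp add: levi_civita_def affine_connection_def additive_on_def)
    show "additive_on (vector_fields A) (D X)" if "X \<in> vector_fields A" for X
      using assms that by (simp add: levi_civita_def affine_connection_def additive_on_def)
    show "additive_on (vector_fields A) (\<lambda>X. app_bilin (metric_of \<kappa> J) X Y)"
      if "Y \<in> vector_fields A" for Y
      using that by (simp add: defs J \<kappa>_left)
    show "additive_on (vector_fields A) (app_bilin (metric_of \<kappa> J) X)"
      if "X \<in> vector_fields A" for X
      using that by (simp add: defs J \<kappa>_right)
    show "X = 0" if "X \<in> vector_fields A" "app_bilin (metric_of \<kappa> J) X X = 0" for X
    proof
      fix p
      have "metric_of \<kappa> J p (X p) (X p) = 0"
        using fun_cong[OF that(2), of p] by (simp add: app_bilin_def)
      then show "X p = 0 p"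
        using assms(4) vector_fieldsD[OF that(1), of p] by (fastforce simp: calibrated_def)
    qed
    show "app_bilin (metric_of \<kappa> J) (app_endo J X) (app_endo J Y) = app_bilin (metric_of \<kappa> J) X Y"
      if "X \<in> vector_fields A" "Y \<in> vector_fields A" for X Y
      using assms(4) that by (simp add: calibrated_def app_bilin_def app_endo_def metric_of_def
          vector_fieldsD J(1))
    show "app_field X (app_bilin (metric_of \<kappa> J) Y Z)
        = app_bilin (metric_of \<kappa> J) (D X Y) Z + app_bilin (metric_of \<kappa> J) Y (D X Z)"
      if "X \<in> vector_fields A" "Y \<in> vector_fields A" "Z \<in> vector_fields A" for X Y Z
      using assms(5) that by (simp add: levi_civita_def)
  qed
qed

theorem theorem4p2:
  fixes A :: "('m::{t2_space,second_countable_topology}, 'e::euclidean_space) chart set"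
    and \<kappa> :: "'m bilin"
    and J :: "'m endo"
    and g :: "'m bilin"
    and D :: "'m vfield \<Rightarrow> 'm vfield \<Rightarrow> 'm vfield"
  assumes "smooth_atlas A"
    and "symplectic_form A \<kappa>"
    and "complex_structure A J"
    and "calibrated A \<kappa> J"
    and "g = metric_of \<kappa> J"
    and "levi_civita A g D"
    and "\<And>Z X Y. Z \<in> complex_fields A \<Longrightarrow> X \<in> complex_fields A \<Longrightarrow> Y \<in> complex_fields A \<Longrightarrow>
           nabla01_tensor21 A J D (B_tensor D J) Z X Y = 0"
  shows "kaehler_structure A g J \<kappa>"
proof -
  have "nijenhuis J X Y = 0" if XY: "X \<in> vector_fields A" "Y \<in> vector_fields A" for X Y
  proof -
    interpret hermitian_calculus "vector_fields A" "app_endo J" D "app_bilin g" app_field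
      using hermitian_calculus_vector_fields[of A \<kappa> J D] assms
      by (simp add: symplectic_form_def)
    have B_eq: "B_tensor D J = B"
      by (simp add: fun_eq_iff B_tensor_def cov_deriv_endo_def B_def P_def)
    have parallel: "D Z (B X Y) = B (D Z X) Y + B X (D Z Y)"
      if "Z \<in> vector_fields A" "X \<in> vector_fields A" "Y \<in> vector_fields A" for Z X Y
    proof -
      \<comment> \<open>The first component of this equation between complex fields is the real part.\<close>
      have "nabla01_tensor21 A J D B (Z + Z, 0) (X, 0) (Y, 0) = 0"
        using assms(7)[of "(Z + Z, 0)" "(X, 0)" "(Y, 0)"] that add[OF that(1) that(1)]
        by (simp add: B_eq complex_fields_def)
      then show ?thesis
        using that part01_double[OF assms(1,3) that(1)]
        by (simp add: nabla01_tensor21_def cov_deriv_tensor21_def cext2_def zero_prod_def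
            algebra_simps)
    qed
    have torsion: "lie_bracket U W = D U W - D W U"
      if "U \<in> vector_fields A" "W \<in> vector_fields A" for U W
      using assms(6) that by (simp add: levi_civita_def)
    have "nijenhuis J X Y = B Y X - B X Y"
      unfolding nijenhuis_def using XY
      by (simp only: torsion J_closed nijenhuis_eq_B)
    then show ?thesis
      using parallel_B_eq_0[OF parallel] XY by simp
  qed
  then show ?thesis
    using assms by (simp add: kaehler_structure_def integrable_structure_def)
qed

end
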